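(* Let $t\in[-1,1]$ and $P=(v_2,v_6,v_1,v_3,v_5)^\top=(1,1,t,t,t)^\top$. Then $P$ is PNS-free, with critical value $1$ and critical minimizer $(1,0,-1,0)^\top$.
   Context: A fourth order four dimensional Hankel tensor $\mathcal{A}=(a_{i_1i_2i_3i_4})$ with generating vector $\mathbf{v}=(v_0,\ldots,v_{12})^\top\in\mathbb{R}^{13}$ is defined by $a_{i_1i_2i_3i_4}=v_{i_1+i_2+i_3+i_4-4}$ for $i_1,i_2,i_3,i_4\in\{1,2,3,4\}$. Its associated polynomial is $f(\mathbf{x})=\sum_{i_1,i_2,i_3,i_4=1}^4 v_{i_1+i_2+i_3+i_4-4}\,x_{i_1}x_{i_2}x_{i_3}x_{i_4}$, $\mathbf{x}\in\mathbb{R}^4$. $\mathcal{A}$ is PSD if $f(\mathbf{x})\ge 0$ for all $\mathbf{x}\in\mathbb{R}^4$; it is SOS if $f$ is a sum of squares of real quadratic homogeneous polynomials. Given $P=(v_2,v_6,v_1,v_3,v_5)^\top\in\mathbb{R}^5$ and $v_0\in\mathbb{R}$, $\mathcal{A}$ denotes the Hankel tensor with generating vector $(v_0,v_1,v_2,v_3,1,v_5,v_6,v_5,1,v_3,v_2,v_1,v_0)^\top$. $M_0(P)$ (respectively $N_0(P)$) denotes the smallest $v_0$ for which $\mathcal{A}$ is SOS (respectively PSD), so that $\mathcal{A}$ is SOS iff $v_0\ge M_0(P)$ and PSD iff $v_0\ge N_0(P)$. $P$ is called PNS-free if $M_0(P)$ and $N_0(P)$ exist and $M_0(P)=N_0(P)$.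 A number $M$ is the critical value, and a point $\bar{\mathbf{x}}\in\mathbb{R}^4$ with $\bar x_1^2+\bar x_4^2>0$ is a critical minimizer, of $\mathcal{A}$ at $P$ if for $v_0=M$ the tensor $\mathcal{A}$ is SOS and its polynomial $f_0$ satisfies $f_0(\bar{\mathbf{x}})=0$. *)

theory Defs
  imports "HOL-Analysis.Analysis"
begin

type_synonym tensor4 = "nat \<Rightarrow> nat \<Rightarrow> nat \<Rightarrow> nat \<Rightarrow> real"

text \<open>A generating vector is a list of length 13; list positions start at 0, so \<open>v ! k\<close> is
  the entry written \<open>v\<^sub>k\<close>.  Tensor indices range over \<open>{1..4}\<close>.\<close>

definition hankel_tensor :: "real list \<Rightarrow> tensor4" where
  "hankel_tensor v = (\<lambda>i1 i2 i3 i4. v ! (i1 + i2 + i3 + i4 - 4))"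

text \<open>In the index type \<open>4\<close> one has \<open>of_nat 4 = 4 = 0\<close>, so \<open>of_nat\<close> maps \<open>{1..4}\<close> bijectively onto
  the index type, and \<open>x $ of_nat i\<close> is the \<open>i\<close>-th entry of \<open>x = vector [x1, x2, x3, x4]\<close>.\<close>

definition tensor_poly :: "tensor4 \<Rightarrow> real ^ 4 \<Rightarrow> real" where
  "tensor_poly A x =
    (\<Sum>i1\<in>{1..4}. \<Sum>i2\<in>{1..4}. \<Sum>i3\<in>{1..4}. \<Sum>i4\<in>{1..4}.
       A i1 i2 i3 i4 * x $ of_nat i1 * x $ of_nat i2 * x $ of_nat i3 * x $ of_nat i4)"

definition PSD :: "tensor4 \<Rightarrow> bool" where
  "PSD A \<longleftrightarrow> (\<forall>x. tensor_poly A x \<ge> 0)"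

text \<open>Real polynomials in four variables are identified with the functions they induce on
  \<open>real ^ 4\<close>, which is harmless because the field is infinite.\<close>

definition quadratic_form :: "(real ^ 4 \<Rightarrow> real) \<Rightarrow> bool" where
  "quadratic_form q \<longleftrightarrow>
    (\<exists>c :: 4 \<Rightarrow> 4 \<Rightarrow> real. \<forall>x. q x = (\<Sum>i\<in>UNIV. \<Sum>j\<in>UNIV. c i j * x $ i * x $ j))"

definition SOS :: "tensor4 \<Rightarrow> bool" where
  "SOS A \<longleftrightarrow>
    (\<exists>(m :: nat) (q :: nat \<Rightarrow> real ^ 4 \<Rightarrow> real). (\<forall>k<m. quadratic_form (q k)) \<and>
       (\<forall>x. tensor_poly A x = (\<Sum>k<m. (q k x)\<^sup>2)))"

text \<open>The components of a parameter point are ordered \<open>(v\<^sub>2, v\<^sub>6, v\<^sub>1, v\<^sub>3, v\<^sub>5)\<close>.\<close>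

type_synonym param = "real \<times> real \<times> real \<times> real \<times> real"

fun gen_vec :: "param \<Rightarrow> real \<Rightarrow> real list" where
  "gen_vec (v2, v6, v1, v3, v5) v0 = [v0, v1, v2, v3, 1, v5, v6, v5, 1, v3, v2, v1, v0]"

definition tensor_at :: "param \<Rightarrow> real \<Rightarrow> tensor4" where
  "tensor_at P v0 = hankel_tensor (gen_vec P v0)"

definition has_least :: "(real \<Rightarrow> bool) \<Rightarrow> bool" where
  "has_least Q \<longleftrightarrow> (\<exists>m. Q m \<and> (\<forall>v. Q v \<longrightarrow> m \<le> v))"

text \<open>\<open>M0\<close> and \<open>N0\<close> are meaningful only when the least element exists, which \<open>PNS_free\<close> demands.\<close>

definition M0 :: "param \<Rightarrow> real" where
  "M0 P = (LEAST v0. SOS (tensor_at P v0))"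

definition N0 :: "param \<Rightarrow> real" where
  "N0 P = (LEAST v0. PSD (tensor_at P v0))"

definition PNS_free :: "param \<Rightarrow> bool" where
  "PNS_free P \<longleftrightarrow>
    has_least (\<lambda>v0. SOS (tensor_at P v0)) \<and> has_least (\<lambda>v0. PSD (tensor_at P v0)) \<and> M0 P = N0 P"

definition critical_value_minimizer :: "param \<Rightarrow> real \<Rightarrow> real ^ 4 \<Rightarrow> bool" where
  "critical_value_minimizer P M xbar \<longleftrightarrow>
    (xbar $ 1)\<^sup>2 + (xbar $ 4)\<^sup>2 > 0 \<and> SOS (tensor_at P M) \<and> tensor_poly (tensor_at P M) xbar = 0"

end

(* For v0 = 1 the generating vector (1,t,1,t,...,1) is the convex combination
   (1+t)/2 * (1^k) + (1-t)/2 * ((-1)^k), and a geometric generating vector gives the fourth power of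
   a linear form.  So f is (1+t)/2 * (x1+x2+x3+x4)^4 + (1-t)/2 * (x1-x2+x3-x4)^4 plus
   (v0-1) * (x1^4 + x4^4).  This is SOS for v0 = 1 and takes the value v0 - 1 at (1,0,-1,0). *)
theory Submission
  imports Defs
begin

lemma tensor_poly_add:
  "tensor_poly (\<lambda>i j k l. A i j k l + B i j k l) x = tensor_poly A x + tensor_poly B x"
  unfolding tensor_poly_def by (simp add: distrib_right sum.distrib)

lemma tensor_poly_scale:
  "tensor_poly (\<lambda>i j k l. c * A i j k l) x = c * tensor_poly A x"
  unfolding tensor_poly_def by (simp add: sum_distrib_left mult.assoc)

lemma tensor_poly_cong:
  assumes "\<And>i j k l. \<lbrakk>i \<in> {1..4}; j \<in> {1..4}; k \<in> {1..4}; l \<in> {1..4}\<rbrakk> \<Longrightarrow> A i j k l = B i j k l"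
  shows "tensor_poly A x = tensor_poly B x"
  unfolding tensor_poly_def by (intro sum.cong refl) (simp add: assms)

text \<open>The fourfold sum of products factors into four copies of one sum. In the index type,
  \<open>of_nat 4\<close> is the index written \<open>4\<close>.\<close>

lemma tensor_poly_rank_one:
  "tensor_poly (\<lambda>i j k l. u i * u j * u k * u l) x =
    (u 1 * x $ 1 + u 2 * x $ 2 + u 3 * x $ 3 + u 4 * x $ 4) ^ 4"
proof -
  have "tensor_poly (\<lambda>i j k l. u i * u j * u k * u l) x = (\<Sum>i\<in>{1..4}. u i * x $ of_nat i) ^ 4"
    unfolding tensor_poly_def
    by (simp add: power4_eq_xxxx sum_distrib_left sum_distrib_right mult_ac)
  also have "(\<Sum>i\<in>{1..4}. u i * x $ of_nat i) =
      u 1 * x $ 1 + u 2 * x $ 2 + u 3 * x $ 3 + u 4 * x $ 4"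
    by (simp add: numeral_eq_Suc)
  finally show ?thesis .
qed

text \<open>The coefficient matrix is \<open>s\<close> times the outer product of \<open>a\<close>
  with itself. The factor \<open>s\<close> lets a weighted fourth power be written as the square of
  such a form.\<close>

lemma quadratic_form_square_linear:
  "quadratic_form (\<lambda>x. s * (\<Sum>i\<in>UNIV. a i * x $ i)\<^sup>2)"
  unfolding quadratic_form_def
  by (rule exI[of _ "\<lambda>i j. s * a i * a j"])
    (simp add: power2_eq_square sum_product sum_distrib_left mult_ac)

lemma SOS_imp_PSD: "SOS A \<Longrightarrow> PSD A"
  unfolding SOS_def PSD_def by (metis sum_nonneg zero_le_power2)

text \<open>Odd positions hold \<open>t\<close>, and even positions hold 1 apart from the two ends;
  the last summand corrects the ends to \<open>v0\<close>.\<close>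

lemma gen_vec_nth:
  assumes "k \<le> 12"
  shows "gen_vec (1, 1, t, t, t) v0 ! k =
    (1 + t) / 2 + (1 - t) / 2 * (- 1) ^ k + (v0 - 1) * (of_bool (k = 0) + of_bool (k = 12))"
proof -
  have "k \<in> {0, 1, 2, 3, 4, 5, 6, 7, 8, 9, 10, 11, 12}"
    using assms by (auto simp: numeral_eq_Suc le_Suc_eq)
  then show ?thesis by (auto simp: field_simps)
qed

lemma tensor_poly_at:
  "tensor_poly (tensor_at (1, 1, t, t, t) v0) x =
    (1 + t) / 2 * (x $ 1 + x $ 2 + x $ 3 + x $ 4) ^ 4 +
    (1 - t) / 2 * (x $ 1 - x $ 2 + x $ 3 - x $ 4) ^ 4 +
    (v0 - 1) * ((x $ 1) ^ 4 + (x $ 4) ^ 4)"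
proof -
  let ?r = "\<lambda>(u :: nat \<Rightarrow> real) i j k l. u i * u j * u k * u l"
  \<comment> \<open>The weights \<open>- ((- 1) ^ i)\<close> run through 1, -1, 1, -1 on the indices
    1 to 4; the four extra minus signs cancel in each product.\<close>
  have "tensor_poly (tensor_at (1, 1, t, t, t) v0) x =
    tensor_poly (\<lambda>i j k l. (1 + t) / 2 * ?r (\<lambda>_. 1) i j k l + (1 - t) / 2 * ?r (\<lambda>i. - ((- 1) ^ i)) i j k l
      + (v0 - 1) * (?r (\<lambda>i. of_bool (i = 1)) i j k l + ?r (\<lambda>i. of_bool (i = 4)) i j k l)) x"
  proof (rule tensor_poly_cong)
    fix i j k l :: nat
    assume *: "i \<in> {1..4}" "j \<in> {1..4}" "k \<in> {1..4}" "l \<in> {1..4}"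
    let ?n = "i + j + k + l - 4"
    \<comment> \<open>Indices are at least 1, so the subtraction in \<open>?n\<close> does not
      truncate, and the shift by 4 preserves the sign.\<close>
    have "(- 1 :: real) ^ i * (- 1) ^ j * (- 1) ^ k * (- 1) ^ l = (- 1) ^ (?n + 4)"
      using * by (simp flip: power_add)
    then have s: "(- 1 :: real) ^ i * (- 1) ^ j * (- 1) ^ k * (- 1) ^ l = (- 1) ^ ?n"
      by (simp add: power_add)
    \<comment> \<open>The extreme index sums 4 and 16 force all indices to agree, so the end
      corrections become products of indicators.\<close>
    have low: "?n = 0 \<longleftrightarrow> i = 1 \<and> j = 1 \<and> k = 1 \<and> l = 1"
      and high: "?n = 12 \<longleftrightarrow> i = 4 \<and> j = 4 \<and> k = 4 \<and> l = 4"
      and "?n \<le> 12" using * by auto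
    from gen_vec_nth[OF \<open>?n \<le> 12\<close>, of t v0]
    show "tensor_at (1, 1, t, t, t) v0 i j k l = (1 + t) / 2 * ?r (\<lambda>_. 1) i j k l
      + (1 - t) / 2 * ?r (\<lambda>i. - ((- 1) ^ i)) i j k l
      + (v0 - 1) * (?r (\<lambda>i. of_bool (i = 1)) i j k l + ?r (\<lambda>i. of_bool (i = 4)) i j k l)"
      unfolding tensor_at_def hankel_tensor_def low high s[symmetric]
      by (simp add: of_bool_conj mult.assoc del: gen_vec.simps)
  qed
  then show ?thesis
    by (simp only: tensor_poly_add tensor_poly_scale tensor_poly_rank_one
        tensor_poly_rank_one[of "\<lambda>_. 1", simplified]) simp
qed

lemma SOS_at_one:
  assumes "t \<in> {-1..1}"
  shows "SOS (tensor_at (1, 1, t, t, t) 1)"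
proof -
  define a :: "nat \<Rightarrow> 4 \<Rightarrow> real" where
    "a k i = (if k = 1 \<and> (i = 2 \<or> i = 4) then - 1 else 1)" for k i
  \<comment> \<open>Each form gets squared, so the weight enters through its square root, which is
    real because \<open>t\<close> lies between -1 and 1.\<close>
  define s where "s k = sqrt ((if k = 0 then 1 + t else 1 - t) / 2)" for k :: nat
  let ?q = "\<lambda>k (x :: real ^ 4). s k * (\<Sum>i\<in>UNIV. a k i * x $ i)\<^sup>2"
  have s2: "(s 0)\<^sup>2 = (1 + t) / 2" "(s (Suc 0))\<^sup>2 = (1 - t) / 2"
    using assms by (simp_all add: s_def)
  have "tensor_poly (tensor_at (1, 1, t, t, t) 1) x = (\<Sum>k<2. (?q k x)\<^sup>2)" for x
    by (simp add: tensor_poly_at lessThan_nat_numeral lessThan_Suc s2 a_def sum_4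
        power_mult_distrib flip: power_mult)
  then show ?thesis
    unfolding SOS_def
    by (intro exI[of _ 2] exI[of _ ?q]) (simp add: quadratic_form_square_linear)
qed

theorem theorem7:
  fixes t :: real and P :: param
  assumes "t \<in> {-1..1}"
    and "P = (1, 1, t, t, t)"
  shows "PNS_free P \<and> critical_value_minimizer P 1 (vector [1, 0, -1, 0])"
proof -
  let ?x = "vector [1, 0, -1, 0] :: real ^ 4"
  have x: "?x $ 1 = 1" "?x $ 2 = 0" "?x $ 3 = -1" "?x $ 4 = 0"
    by (simp_all add: vector_def)
  \<comment> \<open>Both linear forms vanish at \<open>?x\<close>, which leaves only the corner
    terms.\<close>
  have value_x: "tensor_poly (tensor_at P v0) ?x = v0 - 1" for v0
    unfolding assms(2) tensor_poly_at x by simp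
  have SOS1: "SOS (tensor_at P 1)"
    using SOS_at_one[OF assms(1)] assms(2) by simp
  have lower: "1 \<le> v0" if "PSD (tensor_at P v0)" for v0
    using that value_x[of v0] unfolding PSD_def by (metis diff_ge_0_iff_ge)
  \<comment> \<open>The bound for PSD serves both minima, since SOS implies PSD, and both are
    attained at 1.\<close>
  have "M0 P = 1" "N0 P = 1"
    unfolding M0_def N0_def by (auto intro!: Least_equality SOS1 SOS_imp_PSD lower)
  then have "PNS_free P"
    unfolding PNS_free_def has_least_def using SOS1 SOS_imp_PSD lower by metis
  moreover have "critical_value_minimizer P 1 ?x"
    unfolding critical_value_minimizer_def using SOS1 value_x[of 1] x by simp
  ultimately show ?thesis ..
qed

end
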